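(* Let $\gamma,k_B,\omega,q_0>0$ and $T_0>T_1>0$ be real constants. For a small parameter $\epsilon>0$ let $T(t)=T_0+\epsilon T_1\cos(\omega t)$ and let $q(t)=q_0+\epsilon u^*(t)$, where $$u^*(t)=q_1^*\cos(\omega t-\phi^* ),\qquad q_1^*=\frac{q_0\,g\,T_1}{2\gamma\omega T_0},\qquad \phi^*=\angle(\gamma\omega-i\,2q_0),\qquad g=\sqrt{\gamma^2\omega^2+4q_0^2},$$ is the control maximizing (to leading order in $\epsilon$) the power of the overdamped model. Let $\Sigma$ be the $\frac{2\pi}{\omega}$-periodic solution of $\dot\Sigma(t)=-\frac2\gamma q(t)\Sigma(t)+\frac2\gamma k_BT(t)$, and let $$\mathcal W=-\frac12\int_0^{\frac{2\pi}{\omega}}\dot q(t)\Sigma(t)\,dt,\qquad \mathcal Q_h=\int_0^{\frac{2\pi}{\omega}}\Big(\frac12q(t)\dot\Sigma(t)\Big)_+\,dt,\qquad \eta=\frac{\mathcal W}{\mathcal Q_h}.$$ Then, as $\epsilon\to0$, the efficiency at maximum power is $$\eta=\epsilon\,\frac{\pi}{4}\,\frac{T_1}{T_0}+O(\epsilon^2).$$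
   Context: Here $\angle z$ denotes the argument of the nonzero complex number $z$ and $(x)_+=\max\{0,x\}$. The setting is the scalar overdamped Langevin equation $dX_t=-\frac1\gamma q(t)X_t\,dt+\sqrt{\frac{2k_BT(t)}{\gamma}}\,dB_t$ with quadratic potential $\frac12q(t)x^2$ and zero-mean state. $\Sigma(t)=\mathbb E[X_t^2]$ is its periodic variance, $\mathcal W$ is the work extracted over a cycle, $\frac12q\dot\Sigma$ is the heat rate into the ensemble, $\mathcal Q_h$ is the heat flowing in over a cycle, and $\eta$ is the efficiency. *)

theory Defs
  imports "HOL-Analysis.Analysis" "HOL-Library.Landau_Symbols"
begin

definition temperature :: "real \<Rightarrow> real \<Rightarrow> real \<Rightarrow> real \<Rightarrow> real \<Rightarrow> real" where
  "temperature \<omega> T0 T1 \<epsilon> t = T0 + \<epsilon> * T1 * cos (\<omega> * t)"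

definition gain :: "real \<Rightarrow> real \<Rightarrow> real \<Rightarrow> real" where
  "gain \<gamma> \<omega> q0 = sqrt (\<gamma>\<^sup>2 * \<omega>\<^sup>2 + 4 * q0\<^sup>2)"

definition opt_amplitude :: "real \<Rightarrow> real \<Rightarrow> real \<Rightarrow> real \<Rightarrow> real \<Rightarrow> real" where
  "opt_amplitude \<gamma> \<omega> q0 T0 T1 = q0 * gain \<gamma> \<omega> q0 * T1 / (2 * \<gamma> * \<omega> * T0)"

definition opt_phase :: "real \<Rightarrow> real \<Rightarrow> real \<Rightarrow> real" where
  "opt_phase \<gamma> \<omega> q0 = Arg (complex_of_real (\<gamma> * \<omega>) - \<i> * complex_of_real (2 * q0))"

definition opt_control :: "real \<Rightarrow> real \<Rightarrow> real \<Rightarrow> real \<Rightarrow> real \<Rightarrow> real \<Rightarrow> real" where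
  "opt_control \<gamma> \<omega> q0 T0 T1 t =
     opt_amplitude \<gamma> \<omega> q0 T0 T1 * cos (\<omega> * t - opt_phase \<gamma> \<omega> q0)"

definition stiffness :: "real \<Rightarrow> real \<Rightarrow> real \<Rightarrow> real \<Rightarrow> real \<Rightarrow> real \<Rightarrow> real \<Rightarrow> real" where
  "stiffness \<gamma> \<omega> q0 T0 T1 \<epsilon> t = q0 + \<epsilon> * opt_control \<gamma> \<omega> q0 T0 T1 t"

definition periodic_variance ::
    "real \<Rightarrow> real \<Rightarrow> real \<Rightarrow> (real \<Rightarrow> real) \<Rightarrow> (real \<Rightarrow> real) \<Rightarrow> (real \<Rightarrow> real) \<Rightarrow> bool" where
  "periodic_variance \<gamma> kB \<omega> q T \<Sigma> \<longleftrightarrow>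
     (\<forall>t. (\<Sigma> has_real_derivative (- (2 / \<gamma>) * q t * \<Sigma> t + 2 / \<gamma> * kB * T t)) (at t)) \<and>
     (\<forall>t. \<Sigma> (t + 2 * pi / \<omega>) = \<Sigma> t)"

definition work :: "real \<Rightarrow> (real \<Rightarrow> real) \<Rightarrow> (real \<Rightarrow> real) \<Rightarrow> real" where
  "work \<omega> q \<Sigma> = - (1 / 2) * integral {0..2 * pi / \<omega>} (\<lambda>t. deriv q t * \<Sigma> t)"

definition heat_in :: "real \<Rightarrow> (real \<Rightarrow> real) \<Rightarrow> (real \<Rightarrow> real) \<Rightarrow> real" where
  "heat_in \<omega> q \<Sigma> = integral {0..2 * pi / \<omega>} (\<lambda>t. max 0 (1 / 2 * q t * deriv \<Sigma> t))"

definition efficiency :: "real \<Rightarrow> (real \<Rightarrow> real) \<Rightarrow> (real \<Rightarrow> real) \<Rightarrow> real" where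
  "efficiency \<omega> q \<Sigma> = work \<omega> q \<Sigma> / heat_in \<omega> q \<Sigma>"

end

theory Submission
  imports Defs
begin

text \<open>
  At the optimal control the first-order response of the variance is a pure sine,
  \<open>\<Sigma> = kB T0 / q0 + \<epsilon> kB T1 / (\<gamma> \<omega>) sin (\<omega> t) + O(\<epsilon>\<^sup>2)\<close>. The error solves a linear
  equation with damping bounded below and forcing of size \<open>\<epsilon>\<^sup>2\<close>; being periodic, it has a global
  extremum, where its derivative vanishes, and this bounds it uniformly in time by a multiple of
  \<open>\<epsilon>\<^sup>2\<close>. Hence the work is \<open>\<epsilon>\<^sup>2 \<pi> q0 kB T1\<^sup>2 / (4 \<gamma> \<omega> T0) + O(\<epsilon>\<^sup>3)\<close> and the heat
  is \<open>\<epsilon> q0 kB T1 / (\<gamma> \<omega>) + O(\<epsilon>\<^sup>2)\<close>.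
\<close>

section \<open>Periodic functions and damped linear equations\<close>

lemma periodic_shift_into_period:
  fixes f :: "real \<Rightarrow> 'a"
  assumes P: "P > 0" and per: "\<And>t. f (t + P) = f t"
  obtains s where "s \<in> {0..P}" "f s = f t"
proof -
  have nat_shift: "f (x + real n * P) = f x" for x n
  proof (induction n)
    case (Suc n)
    have "f (x + real (Suc n) * P) = f (x + real n * P + P)"
      by (simp add: algebra_simps)
    then show ?case using per Suc.IH by simp
  qed simp
  define k where "k = \<lfloor>t / P\<rfloor>"
  define s where "s = t - of_int k * P"
  have "of_int k \<le> t / P" "t / P < of_int k + 1"
    unfolding k_def by linarith+
  then have "s \<in> {0..P}"
    using P unfolding s_def by (auto simp: field_simps)
  moreover have "f s = f t"
  proof (cases "k \<ge> 0")
    case True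
    then have "t = s + real (nat k) * P" unfolding s_def by simp
    then show ?thesis using nat_shift by metis
  next
    case False
    then have "s = t + real (nat (- k)) * P" unfolding s_def by simp
    then show ?thesis using nat_shift by metis
  qed
  ultimately show thesis using that by blast
qed

text \<open>Where \<open>\<bar>D\<bar>\<close> is largest, either \<open>D\<close> vanishes or its
  derivative does, and then forcing balances damping exactly. Periodicity supplies such a point, so
  no initial value enters the bound.\<close>

lemma periodic_linear_ode_bound:
  fixes D p f :: "real \<Rightarrow> real"
  assumes ode: "\<And>t. (D has_real_derivative f t - p t * D t) (at t)"
    and P: "P > 0" and per: "\<And>t. D (t + P) = D t"
    and m: "m > 0" "\<And>t. m \<le> p t" and f: "\<And>t. \<bar>f t\<bar> \<le> F"
  shows "\<bar>D t\<bar> \<le> F / m"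
proof -
  have "continuous_on {0..P} (\<lambda>t. \<bar>D t\<bar>)"
    by (intro continuous_intros continuous_at_imp_continuous_on)
      (use ode DERIV_isCont in blast)
  then obtain x where x: "\<forall>s \<in> {0..P}. \<bar>D s\<bar> \<le> \<bar>D x\<bar>"
    using continuous_attains_sup[of "{0..P}" "\<lambda>t. \<bar>D t\<bar>"] P
    by (metis atLeastAtMost_iff compact_Icc empty_iff order.refl less_imp_le)
  \<comment> \<open>The maximiser over one period dominates on the whole line, so the derivative
    test applies even if \<open>x\<close> is an endpoint of \<open>{0..P}\<close>.\<close>
  have max: "\<bar>D s\<bar> \<le> \<bar>D x\<bar>" for s
    using periodic_shift_into_period[OF P, of D, OF per, of s] x by metis
  \<comment> \<open>The square has the same maximisers as \<open>\<bar>D\<bar>\<close> but stays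
    differentiable at zeros of \<open>D\<close>; it treats positive maxima and negative minima of
    \<open>D\<close> at once.\<close>
  have "((\<lambda>t. (D t)\<^sup>2) has_real_derivative 2 * D x * (f x - p x * D x)) (at x)"
    by (auto intro!: derivative_eq_intros ode)
  then have "2 * D x * (f x - p x * D x) = 0"
    by (rule DERIV_local_max[of _ _ _ 1]) (use max abs_le_square_iff in auto)
  then have "D x = 0 \<or> p x * D x = f x" by auto
  then have "\<bar>D x\<bar> \<le> F / m"
  proof
    assume "D x = 0"
    moreover have "0 \<le> F" using f[of x] by linarith
    ultimately show ?thesis using m by simp
  next
    assume "p x * D x = f x"
    then have "p x * \<bar>D x\<bar> \<le> F"
      using f[of x] m(1) m(2)[of x] by (metis abs_mult abs_of_pos less_le_trans)
    moreover have "m * \<bar>D x\<bar> \<le> p x * \<bar>D x\<bar>"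
      using m(2) by (intro mult_right_mono) auto
    ultimately show ?thesis using m(1) by (simp add: field_simps)
  qed
  then show ?thesis using max[of t] by linarith
qed

section \<open>Integrals over one period\<close>

text \<open>The cosine is nonnegative on the first and the last quarter of the period, each
  contributing \<open>1 / \<omega>\<close>, and nonpositive in between.\<close>

lemma has_integral_pos_part_cos:
  fixes \<omega> :: real
  assumes \<omega>: "\<omega> > 0"
  shows "((\<lambda>t. max 0 (cos (\<omega> * t))) has_integral 2 / \<omega>) {0..2 * pi / \<omega>}"
proof -
  let ?f = "\<lambda>t. max 0 (cos (\<omega> * t))"
  let ?a = "pi / (2 * \<omega>)" and ?b = "3 * pi / (2 * \<omega>)" and ?c = "2 * pi / \<omega>"
  have ftc: "((\<lambda>t. cos (\<omega> * t)) has_integral sin (\<omega> * y) / \<omega> - sin (\<omega> * x) / \<omega>) {x..y}"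
    if "x \<le> y" for x y
    using that \<omega>
    by (intro fundamental_theorem_of_calculus)
      (auto intro!: derivative_eq_intros simp: has_real_derivative_iff_has_vector_derivative[symmetric])
  have s32: "sin (3 * pi / 2) = -1"
    using sin_periodic_pi[of "pi / 2"] by (simp add: field_simps)
  have "((\<lambda>t. cos (\<omega> * t)) has_integral 1 / \<omega>) {0..?a}"
    using ftc[of 0 ?a] \<omega> by (simp add: sin_pi_half)
  then have 1: "(?f has_integral 1 / \<omega>) {0..?a}"
    by (rule has_integral_eq[rotated])
      (use \<omega> in \<open>auto intro!: max_absorb2[symmetric] cos_ge_zero simp: field_simps
        intro: order_trans[of _ 0]\<close>)
  have 2: "(?f has_integral 0) {?a..?b}"
  proof (rule has_integral_is_0)
    fix t assume "t \<in> {?a..?b}"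
    \<comment> \<open>The shift by \<open>pi\<close> brings the argument between
      \<open>- pi / 2\<close> and \<open>pi / 2\<close>, as \<open>cos_ge_zero\<close> requires; the
      last quarter is shifted by \<open>2 * pi\<close> for the same reason.\<close>
    then have "0 \<le> cos (\<omega> * t - pi)"
      using \<omega> by (intro cos_ge_zero) (auto simp: field_simps)
    then show "?f t = 0" by (simp add: cos_diff)
  qed
  have "((\<lambda>t. cos (\<omega> * t)) has_integral 1 / \<omega>) {?b..?c}"
    using ftc[of ?b ?c] \<omega> s32 by (simp add: field_simps)
  moreover have "cos (\<omega> * t) = ?f t" if "t \<in> {?b..?c}" for t
  proof -
    have "0 \<le> cos (\<omega> * t - 2 * pi)"
      using that \<omega> by (intro cos_ge_zero) (auto simp: field_simps)
    then show ?thesis by (simp add: cos_diff)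
  qed
  ultimately have 3: "(?f has_integral 1 / \<omega>) {?b..?c}"
    by (rule has_integral_eq[rotated])
  have "(?f has_integral 1 / \<omega> + 0) {0..?b}"
    using \<omega> by (intro has_integral_combine[OF _ _ 1 2]) (auto simp: field_simps)
  then have "(?f has_integral 1 / \<omega> + 0 + 1 / \<omega>) {0..?c}"
    using \<omega> by (intro has_integral_combine[OF _ _ _ 3]) (auto simp: field_simps)
  then show ?thesis by simp
qed

lemma integral_abs_diff_le:
  fixes f g :: "real \<Rightarrow> real"
  assumes "f integrable_on {0..P}" "g integrable_on {0..P}" "P \<ge> 0"
    and "\<And>t. t \<in> {0..P} \<Longrightarrow> \<bar>f t - g t\<bar> \<le> c"
  shows "\<bar>integral {0..P} f - integral {0..P} g\<bar> \<le> c * P"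
proof -
  have "norm (integral {0..P} (\<lambda>t. f t - g t)) \<le> integral {0..P} (\<lambda>t. c)"
    using assms by (intro integral_norm_bound_integral integrable_diff) auto
  then show ?thesis using assms by (simp add: integral_diff mult.commute)
qed

section \<open>Quotients of asymptotic expansions\<close>

text \<open>Dividing the error of \<open>W\<close> by \<open>Q\<close>, which is of size
  \<open>x\<close>, lowers its order from 3 to 2; the relative error of \<open>Q\<close>, of order
  \<open>x\<close>, multiplies a ratio that is itself of order \<open>x\<close>.\<close>

lemma quotient_expansion_at_right:
  fixes W Q :: "real \<Rightarrow> real"
  assumes W: "(\<lambda>x. W x - w * x\<^sup>2) \<in> O[at_right 0](\<lambda>x. x ^ 3)"
    and Q: "(\<lambda>x. Q x - h * x) \<in> O[at_right 0](\<lambda>x. x\<^sup>2)" and h: "h > 0"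
  shows "(\<lambda>x. W x / Q x - x * (w / h)) \<in> O[at_right 0](\<lambda>x. x\<^sup>2)"
proof -
  obtain a where a: "a > 0" "\<forall>\<^sub>F x in at_right 0. norm (W x - w * x\<^sup>2) \<le> a * norm (x ^ 3)"
    using W by (rule landau_o.bigE)
  obtain b where b: "b > 0" "\<forall>\<^sub>F x in at_right 0. norm (Q x - h * x) \<le> b * norm (x\<^sup>2)"
    using Q by (rule landau_o.bigE)
  \<comment> \<open>Below this threshold the error \<open>b * x^2\<close> is at most half of
    \<open>h * x\<close>, which keeps \<open>Q x\<close> positive.\<close>
  have "\<forall>\<^sub>F x in at_right 0. x < h / (2 * b)"
    using h b by (intro order_tendstoD) (auto intro: tendsto_ident_at)
  moreover have "\<forall>\<^sub>F x :: real in at_right 0. x > 0"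
    by (rule eventually_at_right_less)
  ultimately have "\<forall>\<^sub>F x in at_right 0.
      norm (W x / Q x - x * (w / h)) \<le> (2 * (a * h + \<bar>w\<bar> * b) / h\<^sup>2) * norm (x\<^sup>2)"
    using a(2) b(2)
  proof eventually_elim
    case (elim x)
    have x: "x > 0" by fact
    have W': "\<bar>W x - w * x\<^sup>2\<bar> \<le> a * x ^ 3" using elim x by simp
    have Q': "\<bar>Q x - h * x\<bar> \<le> b * x\<^sup>2" using elim x by simp
    have "b * x * x \<le> h / 2 * x"
      using elim b x by (intro mult_right_mono) (auto simp: field_simps)
    then have Qlow: "Q x \<ge> h * x / 2"
      using Q' by (auto simp: power2_eq_square algebra_simps abs_le_iff)
    then have Qpos: "Q x > 0" using h x by (smt (verit) divide_pos_pos mult_pos_pos)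
    \<comment> \<open>This is the numerator of \<open>W x / Q x - x * (w / h)\<close> over the
      denominator \<open>Q x * h\<close>, regrouped so that only the two remainders occur: the
      products \<open>w * h * x^2\<close> cancel.\<close>
    have "\<bar>(W x - w * x\<^sup>2) * h - x * w * (Q x - h * x)\<bar>
        \<le> \<bar>W x - w * x\<^sup>2\<bar> * h + x * \<bar>w\<bar> * \<bar>Q x - h * x\<bar>"
      using h x abs_triangle_ineq4[of "(W x - w * x\<^sup>2) * h" "x * w * (Q x - h * x)"]
      by (simp add: abs_mult)
    also have "\<dots> \<le> a * x ^ 3 * h + x * \<bar>w\<bar> * (b * x\<^sup>2)"
      using W' Q' h x by (intro add_mono mult_right_mono mult_left_mono) auto
    also have "\<dots> = (a * h + \<bar>w\<bar> * b) * x ^ 3"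
      by (simp add: algebra_simps power2_eq_square power3_eq_cube)
    finally have num: "\<bar>(W x - w * x\<^sup>2) * h - x * w * (Q x - h * x)\<bar>
        \<le> (a * h + \<bar>w\<bar> * b) * x ^ 3" .
    have den: "0 < h * x / 2 * h" "h * x / 2 * h \<le> Q x * h"
      using h x mult_right_mono[OF Qlow, of h] by auto
    have "W x / Q x - x * (w / h) = ((W x - w * x\<^sup>2) * h - x * w * (Q x - h * x)) / (Q x * h)"
      using Qpos h by (simp add: field_simps power2_eq_square)
    then have "\<bar>W x / Q x - x * (w / h)\<bar>
        = \<bar>(W x - w * x\<^sup>2) * h - x * w * (Q x - h * x)\<bar> / (Q x * h)"
      using Qpos h by simp
    also have "\<dots> \<le> ((a * h + \<bar>w\<bar> * b) * x ^ 3) / (h * x / 2 * h)"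
      using num den by (intro frac_le) auto
    also have "\<dots> = (2 * (a * h + \<bar>w\<bar> * b) / h\<^sup>2) * x\<^sup>2"
      using h x by (simp add: field_simps power2_eq_square power3_eq_cube)
    finally show ?case by simp
  qed
  then show ?thesis by (rule bigoI)
qed

section \<open>The optimal control in trigonometric form and its leading work\<close>

locale optimal_cycle =
  fixes \<gamma> kB \<omega> q0 T0 T1 :: real
  assumes pos: "\<gamma> > 0" "kB > 0" "\<omega> > 0" "q0 > 0" "T0 > 0" "T1 > 0"
begin

text \<open>\<open>A\<close> and \<open>B\<close> come from expanding the phase-shifted cosine of
  the control; \<open>b\<close> is the amplitude of the variance response at first order in
  \<open>\<epsilon>\<close>.\<close>

definition A where "A = q0 * T1 / (2 * T0)"
definition B where "B = q0\<^sup>2 * T1 / (\<gamma> * \<omega> * T0)"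
definition b where "b = kB * T1 / (\<gamma> * \<omega>)"
definition u where "u t = A * cos (\<omega> * t) - B * sin (\<omega> * t)"
definition u' where "u' t = - \<omega> * (A * sin (\<omega> * t) + B * cos (\<omega> * t))"

lemma consts_pos: "A > 0" "B > 0" "b > 0"
  unfolding A_def B_def b_def using pos by auto

text \<open>\<open>gain\<close> is the modulus of the complex number whose argument is the phase, so
  it cancels between the amplitude and the cosine and sine of the phase.\<close>

lemma opt_control_eq: "opt_control \<gamma> \<omega> q0 T0 T1 t = u t"
proof -
  define z where "z = complex_of_real (\<gamma> * \<omega>) - \<i> * complex_of_real (2 * q0)"
  define g where "g = gain \<gamma> \<omega> q0"
  have "\<gamma> * \<omega> > 0" using pos by simp
  then have z: "z \<noteq> 0" "Re z = \<gamma> * \<omega>" "Im z = - 2 * q0"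
    unfolding z_def by (auto simp: complex_eq_iff)
  have "cmod z = g"
    unfolding g_def gain_def by (simp add: cmod_def z power_mult_distrib)
  moreover from this have g: "g > 0" using z by (metis zero_less_norm_iff)
  ultimately have phase:
    "cos (opt_phase \<gamma> \<omega> q0) = \<gamma> * \<omega> / g" "sin (opt_phase \<gamma> \<omega> q0) = - 2 * q0 / g"
    unfolding opt_phase_def z_def[symmetric] using z by (simp_all add: cos_Arg sin_Arg)
  show ?thesis
    unfolding opt_control_def opt_amplitude_def u_def A_def B_def cos_diff phase g_def[symmetric]
    using pos g by (simp add: field_simps power2_eq_square)
qed

lemma u_deriv: "(u has_real_derivative u' t) (at t)"
  unfolding u_def[abs_def] u'_def
  by (auto intro!: derivative_eq_intros simp: algebra_simps)

lemma abs_u_le: "\<bar>u t\<bar> \<le> A + B"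
proof -
  have "\<bar>A * cos (\<omega> * t)\<bar> \<le> A" "\<bar>B * sin (\<omega> * t)\<bar> \<le> B"
    using consts_pos by (simp_all add: abs_mult mult_left_le)
  then show ?thesis unfolding u_def by linarith
qed

lemma abs_u'_le: "\<bar>u' t\<bar> \<le> \<omega> * (A + B)"
proof -
  have "\<bar>A * sin (\<omega> * t)\<bar> \<le> A" "\<bar>B * cos (\<omega> * t)\<bar> \<le> B"
    using consts_pos by (simp_all add: abs_mult mult_left_le)
  then have "\<bar>A * sin (\<omega> * t) + B * cos (\<omega> * t)\<bar> \<le> A + B" by linarith
  then show ?thesis unfolding u'_def using pos by (simp add: abs_mult)
qed

text \<open>Over a full period \<open>u'\<close> is orthogonal to constants, and its cosine part is
  orthogonal to the sine; only the mean of the squared sine survives.\<close>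

lemma has_integral_leading_work:
  "((\<lambda>t. u' t * (c + \<epsilon> * b * sin (\<omega> * t))) has_integral (- (\<epsilon> * b * A * pi))) {0..2 * pi / \<omega>}"
proof -
  \<comment> \<open>The only non-periodic term of this antiderivative is
    \<open>A * \<omega> * t / 2\<close>, which grows by \<open>A * pi\<close> over the
    cycle.\<close>
  define F where "F t = c * u t - \<epsilon> * b * (A * (\<omega> * t - sin (\<omega> * t) * cos (\<omega> * t)) / 2
      + B * (sin (\<omega> * t))\<^sup>2 / 2)" for t
  have "(F has_real_derivative u' t * (c + \<epsilon> * b * sin (\<omega> * t))) (at t)" for t
  proof -
    have "(F has_real_derivative (c * u' t - \<epsilon> * b * (A * (\<omega> - (\<omega> * (cos (\<omega> * t))\<^sup>2
        - \<omega> * (sin (\<omega> * t))\<^sup>2)) / 2 + B * \<omega> * sin (\<omega> * t) * cos (\<omega> * t)))) (at t)"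
      unfolding F_def[abs_def]
      by (auto intro!: derivative_eq_intros u_deriv simp: field_simps power2_eq_square)
    then show ?thesis
      by (rule DERIV_cong, unfold u'_def cos_squared_eq) (simp add: field_simps power2_eq_square)
  qed
  then have "((\<lambda>t. u' t * (c + \<epsilon> * b * sin (\<omega> * t))) has_integral F (2 * pi / \<omega>) - F 0)
      {0..2 * pi / \<omega>}"
    using pos
    by (intro fundamental_theorem_of_calculus)
      (auto simp: has_real_derivative_iff_has_vector_derivative[symmetric]
        intro: has_field_derivative_at_within)
  moreover have "F (2 * pi / \<omega>) - F 0 = - (\<epsilon> * b * A * pi)"
    using pos by (simp add: F_def u_def)
  ultimately show ?thesis by simp
qed

abbreviation "leading \<epsilon> t \<equiv> kB * T0 / q0 + \<epsilon> * b * sin (\<omega> * t)"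

section \<open>Error estimates at a fixed small \<open>\<epsilon>\<close>\<close>

context
  fixes \<epsilon> :: real and S :: "real \<Rightarrow> real"
  assumes \<epsilon>: "\<epsilon> > 0" "\<epsilon> * (A + B) \<le> q0 / 2"
    and variance: "periodic_variance \<gamma> kB \<omega>
      (stiffness \<gamma> \<omega> q0 T0 T1 \<epsilon>) (temperature \<omega> T0 T1 \<epsilon>) S"
begin

lemma stiffness_eq: "stiffness \<gamma> \<omega> q0 T0 T1 \<epsilon> t = q0 + \<epsilon> * u t"
  by (simp add: stiffness_def opt_control_eq)

text \<open>The smallness of \<open>\<epsilon>\<close> confines the perturbation to half of
  \<open>q0\<close>. The lower bound yields damping at least \<open>q0 / \<gamma>\<close>; the upper
  one serves the estimates of the derivative and the heat.\<close>

lemma stiffness_bounds: "q0 / 2 \<le> q0 + \<epsilon> * u t" "q0 + \<epsilon> * u t \<le> 2 * q0"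
proof -
  have "\<bar>\<epsilon> * u t\<bar> \<le> \<epsilon> * (A + B)"
    using \<epsilon> abs_u_le[of t] by (simp add: abs_mult)
  then show "q0 / 2 \<le> q0 + \<epsilon> * u t" "q0 + \<epsilon> * u t \<le> 2 * q0"
    using \<epsilon> pos by linarith+
qed

lemma S_deriv:
  "(S has_real_derivative
      - (2 / \<gamma>) * (q0 + \<epsilon> * u t) * S t + 2 / \<gamma> * kB * (T0 + \<epsilon> * T1 * cos (\<omega> * t))) (at t)"
  and S_periodic: "S (t + 2 * pi / \<omega>) = S t"
  using variance by (auto simp: periodic_variance_def stiffness_eq temperature_def)

text \<open>\<open>leading\<close> solves the variance equation to first order: the sine terms
  cancel because \<open>B * kB * T0 / q0 = q0 * b\<close>, and the cosine terms leave
  \<open>b * \<omega>\<close>. The forcing that remains is the product of the perturbations of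
  stiffness and variance.\<close>

lemma S_error_deriv:
  "((\<lambda>t. S t - leading \<epsilon> t) has_real_derivative
      (- (2 / \<gamma>) * \<epsilon>\<^sup>2 * b * u t * sin (\<omega> * t))
      - (2 / \<gamma>) * (q0 + \<epsilon> * u t) * (S t - leading \<epsilon> t)) (at t)"
proof -
  have "((\<lambda>t. S t - leading \<epsilon> t) has_real_derivative
      (- (2 / \<gamma>) * (q0 + \<epsilon> * u t) * S t + 2 / \<gamma> * kB * (T0 + \<epsilon> * T1 * cos (\<omega> * t)))
      - \<epsilon> * b * \<omega> * cos (\<omega> * t)) (at t)"
    by (auto intro!: derivative_eq_intros S_deriv)
  then show ?thesis
    by (rule DERIV_cong)
      (use pos in \<open>simp add: u_def A_def B_def b_def field_simps power2_eq_square\<close>)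
qed

lemma forcing_le: "\<bar>- (2 / \<gamma>) * \<epsilon>\<^sup>2 * b * u t * sin (\<omega> * t)\<bar> \<le> 2 / \<gamma> * \<epsilon>\<^sup>2 * b * (A + B)"
proof -
  have "\<bar>u t\<bar> * \<bar>sin (\<omega> * t)\<bar> \<le> (A + B) * 1"
    using abs_u_le consts_pos by (intro mult_mono) auto
  then have "(2 / \<gamma> * \<epsilon>\<^sup>2 * b) * (\<bar>u t\<bar> * \<bar>sin (\<omega> * t)\<bar>) \<le> (2 / \<gamma> * \<epsilon>\<^sup>2 * b) * ((A + B) * 1)"
    using pos consts_pos by (intro mult_left_mono) auto
  then show ?thesis using pos consts_pos by (simp add: abs_mult mult.assoc)
qed

lemma S_error_le: "\<bar>S t - leading \<epsilon> t\<bar> \<le> 2 * b * (A + B) / q0 * \<epsilon>\<^sup>2"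
proof -
  have "\<bar>S t - leading \<epsilon> t\<bar> \<le> (2 / \<gamma> * \<epsilon>\<^sup>2 * b * (A + B)) / (q0 / \<gamma>)"
  proof (rule periodic_linear_ode_bound[OF S_error_deriv])
    show "S (t + 2 * pi / \<omega>) - leading \<epsilon> (t + 2 * pi / \<omega>) = S t - leading \<epsilon> t" for t
      using pos S_periodic by (simp add: distrib_left)
    show "q0 / \<gamma> \<le> 2 / \<gamma> * (q0 + \<epsilon> * u t)" for t
      using pos stiffness_bounds(1)[of t] by (simp add: field_simps)
  qed (use pos forcing_le in auto)
  also have "\<dots> = 2 * b * (A + B) / q0 * \<epsilon>\<^sup>2"
    using pos by simp
  finally show ?thesis .
qed

text \<open>The error equation itself turns the bound on the error into one on its derivative; of
  the constant 10, the forcing contributes 2 and the damping term 8.\<close>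

lemma S_deriv_error_le:
  "\<bar>deriv S t - \<epsilon> * b * \<omega> * cos (\<omega> * t)\<bar> \<le> 10 / \<gamma> * b * (A + B) * \<epsilon>\<^sup>2"
proof -
  define D where "D = S t - leading \<epsilon> t"
  have "((\<lambda>t. S t - leading \<epsilon> t) has_real_derivative
      deriv S t - \<epsilon> * b * \<omega> * cos (\<omega> * t)) (at t)"
    using DERIV_imp_deriv[OF S_deriv, of t]
    by (auto intro!: derivative_eq_intros S_deriv)
  then have "deriv S t - \<epsilon> * b * \<omega> * cos (\<omega> * t)
      = (- (2 / \<gamma>) * \<epsilon>\<^sup>2 * b * u t * sin (\<omega> * t)) - (2 / \<gamma>) * (q0 + \<epsilon> * u t) * D"
    unfolding D_def using S_error_deriv by (rule DERIV_unique)
  also have "\<bar>\<dots>\<bar> \<le> \<bar>- (2 / \<gamma>) * \<epsilon>\<^sup>2 * b * u t * sin (\<omega> * t)\<bar>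
      + \<bar>(2 / \<gamma>) * (q0 + \<epsilon> * u t) * D\<bar>"
    by (rule abs_triangle_ineq4)
  also have "\<bar>(2 / \<gamma>) * (q0 + \<epsilon> * u t) * D\<bar>
      \<le> (2 / \<gamma>) * (2 * q0) * (2 * b * (A + B) / q0 * \<epsilon>\<^sup>2)"
    unfolding abs_mult D_def using pos stiffness_bounds[of t] S_error_le[of t]
    by (intro mult_mono) auto
  also note forcing_le
  also have "2 / \<gamma> * \<epsilon>\<^sup>2 * b * (A + B) + (2 / \<gamma>) * (2 * q0) * (2 * b * (A + B) / q0 * \<epsilon>\<^sup>2)
      = 10 / \<gamma> * b * (A + B) * \<epsilon>\<^sup>2"
    using pos by (simp add: field_simps)
  finally show ?thesis by simp
qed

lemma continuous_on_cycle:
  "continuous_on X S" "continuous_on X u" "continuous_on X u'" "continuous_on X (deriv S)"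
proof -
  show S: "continuous_on X S" and u: "continuous_on X u"
    using S_deriv u_deriv DERIV_isCont by (blast intro: continuous_at_imp_continuous_on)+
  show "continuous_on X u'"
    unfolding u'_def[abs_def] by (intro continuous_intros)
  \<comment> \<open>Continuity is read off the equation. It gives integrability of the heat rate,
    without which \<open>integral\<close> would default to 0.\<close>
  have "deriv S = (\<lambda>t. - (2 / \<gamma>) * (q0 + \<epsilon> * u t) * S t
      + 2 / \<gamma> * kB * (T0 + \<epsilon> * T1 * cos (\<omega> * t)))"
    using DERIV_imp_deriv[OF S_deriv] by blast
  then show "continuous_on X (deriv S)"
    by (simp only:) (intro continuous_intros S u)
qed

text \<open>Replacing \<open>S\<close> by \<open>leading\<close> costs order
  \<open>\<epsilon>^2\<close> in the integral, and the derivative of the stiffness carries one more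
  factor \<open>\<epsilon>\<close>.\<close>

lemma work_error_le:
  "\<bar>work \<omega> (stiffness \<gamma> \<omega> q0 T0 T1 \<epsilon>) S - b * A * pi / 2 * \<epsilon>\<^sup>2\<bar>
    \<le> 2 * pi * b * (A + B)\<^sup>2 / q0 * \<epsilon> ^ 3"
proof -
  have "(stiffness \<gamma> \<omega> q0 T0 T1 \<epsilon> has_real_derivative \<epsilon> * u' t) (at t)" for t
    unfolding stiffness_eq[abs_def] by (auto intro!: derivative_eq_intros u_deriv)
  then have "deriv (stiffness \<gamma> \<omega> q0 T0 T1 \<epsilon>) t = \<epsilon> * u' t" for t
    by (rule DERIV_imp_deriv)
  then have work: "work \<omega> (stiffness \<gamma> \<omega> q0 T0 T1 \<epsilon>) S
      = - (\<epsilon> / 2) * integral {0..2 * pi / \<omega>} (\<lambda>t. u' t * S t)"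
    by (simp add: work_def mult.assoc)
  have "\<bar>integral {0..2 * pi / \<omega>} (\<lambda>t. u' t * S t)
      - integral {0..2 * pi / \<omega>} (\<lambda>t. u' t * leading \<epsilon> t)\<bar>
      \<le> (\<omega> * (A + B)) * (2 * b * (A + B) / q0 * \<epsilon>\<^sup>2) * (2 * pi / \<omega>)"
  proof (rule integral_abs_diff_le)
    fix t
    have "\<bar>u' t\<bar> * \<bar>S t - leading \<epsilon> t\<bar> \<le> (\<omega> * (A + B)) * (2 * b * (A + B) / q0 * \<epsilon>\<^sup>2)"
      using pos consts_pos abs_u'_le[of t] S_error_le[of t] by (intro mult_mono) auto
    then show "\<bar>u' t * S t - u' t * leading \<epsilon> t\<bar>
        \<le> (\<omega> * (A + B)) * (2 * b * (A + B) / q0 * \<epsilon>\<^sup>2)"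
      by (simp only: right_diff_distrib[symmetric] abs_mult)
  qed (use pos in \<open>auto intro!: integrable_continuous_real continuous_intros continuous_on_cycle\<close>)
  then have "\<bar>integral {0..2 * pi / \<omega>} (\<lambda>t. u' t * S t) + \<epsilon> * b * A * pi\<bar>
      \<le> 4 * pi * b * (A + B)\<^sup>2 / q0 * \<epsilon>\<^sup>2"
    unfolding integral_unique[OF has_integral_leading_work]
    using pos by (simp add: power2_eq_square mult_ac)
  then have "\<epsilon> / 2 * \<bar>integral {0..2 * pi / \<omega>} (\<lambda>t. u' t * S t) + \<epsilon> * b * A * pi\<bar>
      \<le> \<epsilon> / 2 * (4 * pi * b * (A + B)\<^sup>2 / q0 * \<epsilon>\<^sup>2)"
    using \<epsilon> by (intro mult_left_mono) auto
  moreover have "work \<omega> (stiffness \<gamma> \<omega> q0 T0 T1 \<epsilon>) S - b * A * pi / 2 * \<epsilon>\<^sup>2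
      = - (\<epsilon> / 2) * (integral {0..2 * pi / \<omega>} (\<lambda>t. u' t * S t) + \<epsilon> * b * A * pi)"
    unfolding work by (simp add: algebra_simps power2_eq_square)
  ultimately show ?thesis
    using \<epsilon> by (simp add: abs_mult power2_eq_square power3_eq_cube mult_ac)
qed

text \<open>The positive part is 1-Lipschitz, so a uniform error of the heat rate passes through it
  without locating the sign changes of that rate.\<close>

lemma heat_in_error_le:
  "\<bar>heat_in \<omega> (stiffness \<gamma> \<omega> q0 T0 T1 \<epsilon>) S - q0 * b * \<epsilon>\<bar>
    \<le> (q0 * (10 / \<gamma> * b * (A + B)) + (A + B) * b * \<omega> / 2) * (2 * pi / \<omega>) * \<epsilon>\<^sup>2"
proof -
  let ?c = "q0 * (10 / \<gamma> * b * (A + B) * \<epsilon>\<^sup>2) + (A + B) * b * \<omega> / 2 * \<epsilon>\<^sup>2"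
  let ?g = "\<lambda>t. q0 / 2 * (\<epsilon> * b * \<omega>) * max 0 (cos (\<omega> * t))"
  have "(?g has_integral (q0 / 2 * (\<epsilon> * b * \<omega>) * (2 / \<omega>))) {0..2 * pi / \<omega>}"
    using pos by (intro has_integral_mult_right has_integral_pos_part_cos)
  from integral_unique[OF this] have g: "integral {0..2 * pi / \<omega>} ?g = q0 * b * \<epsilon>"
    by (rule trans) (use pos in simp)
  have "\<bar>heat_in \<omega> (stiffness \<gamma> \<omega> q0 T0 T1 \<epsilon>) S - integral {0..2 * pi / \<omega>} ?g\<bar>
      \<le> ?c * (2 * pi / \<omega>)"
    unfolding heat_in_def stiffness_eq
  proof (rule integral_abs_diff_le)
    fix t
    define d where "d = \<epsilon> * b * \<omega> * cos (\<omega> * t)"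
    have g: "?g t = max 0 (q0 / 2 * d)"
      unfolding d_def using pos \<epsilon> consts_pos
      by (simp add: max_mult_distrib_left mult.assoc)
    have "\<bar>max 0 (1 / 2 * (q0 + \<epsilon> * u t) * deriv S t) - max 0 (q0 / 2 * d)\<bar>
        \<le> \<bar>1 / 2 * (q0 + \<epsilon> * u t) * deriv S t - q0 / 2 * d\<bar>"
      by (simp add: max_def)
    \<comment> \<open>The first summand carries the error of the derivative, the second the
      variation of the stiffness; both are of order \<open>\<epsilon>^2\<close>.\<close>
    also have "1 / 2 * (q0 + \<epsilon> * u t) * deriv S t - q0 / 2 * d
        = 1 / 2 * (q0 + \<epsilon> * u t) * (deriv S t - d) + \<epsilon> / 2 * u t * d"
      by (simp add: field_simps)
    also have "\<bar>\<dots>\<bar> \<le> \<bar>1 / 2 * (q0 + \<epsilon> * u t) * (deriv S t - d)\<bar> + \<bar>\<epsilon> / 2 * u t * d\<bar>"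
      by (rule abs_triangle_ineq)
    also have "\<bar>1 / 2 * (q0 + \<epsilon> * u t) * (deriv S t - d)\<bar>
        \<le> q0 * (10 / \<gamma> * b * (A + B) * \<epsilon>\<^sup>2)"
      unfolding abs_mult[of _ "deriv S t - d"]
      using pos stiffness_bounds[of t] S_deriv_error_le[of t]
      by (intro mult_mono) (auto simp: d_def)
    also have "\<bar>\<epsilon> / 2 * u t * d\<bar> \<le> \<epsilon> / 2 * (A + B) * (\<epsilon> * b * \<omega>)"
    proof -
      have "\<bar>d\<bar> \<le> \<epsilon> * b * \<omega>"
        unfolding d_def using pos \<epsilon> consts_pos by (simp add: abs_mult mult_left_le)
      then show ?thesis
        unfolding abs_mult using \<epsilon> consts_pos abs_u_le[of t] by (intro mult_mono) auto
    qed
    also have "\<epsilon> / 2 * (A + B) * (\<epsilon> * b * \<omega>) = (A + B) * b * \<omega> / 2 * \<epsilon>\<^sup>2"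
      by (simp add: power2_eq_square)
    finally show "\<bar>max 0 (1 / 2 * (q0 + \<epsilon> * u t) * deriv S t) - ?g t\<bar> \<le> ?c"
      unfolding g by simp
  qed (use pos in \<open>auto intro!: integrable_continuous_real continuous_intros continuous_on_cycle\<close>)
  then show ?thesis unfolding g by (simp only: ring_distribs mult_ac)
qed

end

section \<open>Asymptotics of the efficiency\<close>

lemma efficiency_expansion:
  assumes "\<forall>\<^sub>F \<epsilon> in at_right 0.
      periodic_variance \<gamma> kB \<omega> (stiffness \<gamma> \<omega> q0 T0 T1 \<epsilon>) (temperature \<omega> T0 T1 \<epsilon>) (\<Sigma> \<epsilon>)"
  shows "(\<lambda>\<epsilon>. efficiency \<omega> (stiffness \<gamma> \<omega> q0 T0 T1 \<epsilon>) (\<Sigma> \<epsilon>) - \<epsilon> * (pi / 4) * (T1 / T0))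
           \<in> O[at_right 0](\<lambda>\<epsilon>. \<epsilon>\<^sup>2)"
proof -
  let ?q = "stiffness \<gamma> \<omega> q0 T0 T1"
  have "\<forall>\<^sub>F \<epsilon> in at_right 0. \<epsilon> < q0 / (2 * (A + B))"
    using pos consts_pos by (intro order_tendstoD) (auto intro: tendsto_ident_at)
  moreover have "\<forall>\<^sub>F \<epsilon> :: real in at_right 0. \<epsilon> > 0"
    by (rule eventually_at_right_less)
  ultimately have ev: "\<forall>\<^sub>F \<epsilon> in at_right 0. \<epsilon> > 0 \<and> \<epsilon> * (A + B) \<le> q0 / 2 \<and>
      periodic_variance \<gamma> kB \<omega> (?q \<epsilon>) (temperature \<omega> T0 T1 \<epsilon>) (\<Sigma> \<epsilon>)"
    using assms by eventually_elim (use consts_pos in \<open>auto simp: field_simps\<close>)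
  have W: "(\<lambda>\<epsilon>. work \<omega> (?q \<epsilon>) (\<Sigma> \<epsilon>) - b * A * pi / 2 * \<epsilon>\<^sup>2) \<in> O[at_right 0](\<lambda>\<epsilon>. \<epsilon> ^ 3)"
  proof (rule bigoI)
    show "\<forall>\<^sub>F \<epsilon> in at_right 0. norm (work \<omega> (?q \<epsilon>) (\<Sigma> \<epsilon>) - b * A * pi / 2 * \<epsilon>\<^sup>2)
        \<le> 2 * pi * b * (A + B)\<^sup>2 / q0 * norm (\<epsilon> ^ 3)"
      using ev by eventually_elim (use work_error_le in force)
  qed
  have Q: "(\<lambda>\<epsilon>. heat_in \<omega> (?q \<epsilon>) (\<Sigma> \<epsilon>) - q0 * b * \<epsilon>) \<in> O[at_right 0](\<lambda>\<epsilon>. \<epsilon>\<^sup>2)"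
  proof (rule bigoI)
    show "\<forall>\<^sub>F \<epsilon> in at_right 0. norm (heat_in \<omega> (?q \<epsilon>) (\<Sigma> \<epsilon>) - q0 * b * \<epsilon>)
        \<le> (q0 * (10 / \<gamma> * b * (A + B)) + (A + B) * b * \<omega> / 2) * (2 * pi / \<omega>) * norm (\<epsilon>\<^sup>2)"
      using ev by eventually_elim (use heat_in_error_le in force)
  qed
  \<comment> \<open>Cancelling \<open>b\<close> removes \<open>kB\<close>, \<open>\<gamma>\<close>
    and \<open>\<omega>\<close>; what is left is \<open>A / q0 = T1 / (2 * T0)\<close>.\<close>
  have "b * A * pi / 2 / (q0 * b) = pi / 4 * (T1 / T0)"
    using pos consts_pos(3) by (simp add: A_def)
  then show ?thesis
    using quotient_expansion_at_right[OF W Q] pos consts_pos(3)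
    by (simp add: efficiency_def mult.assoc)
qed

end

theorem mainTheorem3:
  fixes \<gamma> kB \<omega> q0 T0 T1 :: real
    and \<Sigma> :: "real \<Rightarrow> real \<Rightarrow> real"
  assumes "\<gamma> > 0" and "kB > 0" and "\<omega> > 0" and "q0 > 0"
    and "T0 > T1" and "T1 > 0"
    and "\<forall>\<^sub>F \<epsilon> in at_right 0.
           periodic_variance \<gamma> kB \<omega> (stiffness \<gamma> \<omega> q0 T0 T1 \<epsilon>) (temperature \<omega> T0 T1 \<epsilon>) (\<Sigma> \<epsilon>)"
  shows "(\<lambda>\<epsilon>. efficiency \<omega> (stiffness \<gamma> \<omega> q0 T0 T1 \<epsilon>) (\<Sigma> \<epsilon>) - \<epsilon> * (pi / 4) * (T1 / T0))
           \<in> O[at_right 0](\<lambda>\<epsilon>. \<epsilon>\<^sup>2)"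
proof -
  interpret optimal_cycle \<gamma> kB \<omega> q0 T0 T1
    using assms by unfold_locales auto
  show ?thesis using assms(7) by (rule efficiency_expansion)
qed

end
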